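(* Let $S\subset\mathbb{R}^n$ be a nonempty closed set satisfying the extended exterior $r(\cdot)$-sphere condition for some continuous function $r(\cdot)\colon\operatorname{bdry}S\to\,]0,+\infty]$. Define $\rho\colon S^c\to\,]0,+\infty]$ by $\rho(x):=\min\{r(s)/2 : s\in\operatorname{proj}_S(x)\}$, and for $\gamma>0$ define $\varrho_\gamma\colon S^c\to\,]0,+\infty]$ by $$\varrho_\gamma(x):=\max\Big\{\gamma\, d_S(x),\ \tfrac12\sqrt{\gamma^2 d_S(x)^2+4\rho(x)^2}\Big\}.$$ Then for every $\gamma$ with $\frac{1}{2\sqrt3-2}\le\gamma<1$, the function $\varrho_\gamma$ is lower semicontinuous and $S^c$ is the union of closed balls with radius function $\varrho_\gamma(\cdot)$.
   Context: Notation: $S^c$, $\operatorname{int}S$, $\operatorname{bdry}S$ denote complement, interior and boundary; $d_S(x)$ is the Euclidean distance from $x$ to $S$ and $\operatorname{proj}_S(x)=\{s\in S: \|s-x\|=d_S(x)\}$. $B(z;\delta)$ and $\bar B(z;\delta)$ are the open and closed balls of center $z$ and radius $\delta$. Values $+\infty$ are handled with the usual conventions (so $\rho(x)=+\infty$ gives $\varrho_\gamma(x)=+\infty$). Proximal normal cone: for $s\in S$, $N^P_S(s)$ is the set of $\zeta\in\mathbb{R}^n$ for which there is $\sigma\ge0$ with $\langle\zeta,x-s\rangle\le\sigma\|x-s\|^2$ for all $x\in S$. A unit vector $\zeta\in N^P_S(s)$ is said to be realized by a $\rho$-sphere ($\rho>0$) if $B(s+\rho\zeta;\rho)\cap S=\emptyset$,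 equivalently $\langle\zeta,x-s\rangle\le\frac{1}{2\rho}\|x-s\|^2$ for all $x\in S$. Extended exterior $r(\cdot)$-sphere condition: for every $s\in\operatorname{bdry}S$: (a) if $s\in\operatorname{bdry}(\operatorname{int}S)$, there exists a unit vector $\zeta_s\in N^P_S(s)$ that is realized by an $r(s)$-sphere when $r(s)<+\infty$, and realized by a $\rho$-sphere for every $\rho>0$ (i.e. $\langle\zeta_s,x-s\rangle\le0$ for all $x\in S$) when $r(s)=+\infty$; (b) if $s\notin\operatorname{bdry}(\operatorname{int}S)$, then every unit vector $\zeta_s\in N^P_S(s)$ has this property. Union of closed balls: a nonempty open set $\mathcal{O}$ is the union of closed balls with lower semicontinuous radius function $\varrho\colon\mathcal{O}\to\,]0,+\infty]$ if for every $x\in\mathcal{O}$ there exists $y_x\in\mathcal{O}$ such that $x\in\bar B(y_x;\varrho(x))\subset\mathcal{O}$ if $\varrho(x)<+\infty$, and $x\in\bar B(x+\delta(y_x-x);\delta)\subset\mathcal{O}$ for all $\delta>0$ if $\varrho(x)=+\infty$. *)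

theory Defs
  imports "HOL-Analysis.Analysis"
begin

definition proj_set :: "'a::euclidean_space set \<Rightarrow> 'a \<Rightarrow> 'a set" where
  "proj_set S x = {s \<in> S. dist x s = infdist x S}"

definition prox_normal_cone :: "'a::euclidean_space set \<Rightarrow> 'a \<Rightarrow> 'a set" where
  "prox_normal_cone S s =
     {\<zeta>. \<exists>\<sigma>\<ge>0. \<forall>x\<in>S. inner \<zeta> (x - s) \<le> \<sigma> * (norm (x - s))\<^sup>2}"

definition realized_by_sphere :: "'a::euclidean_space set \<Rightarrow> 'a \<Rightarrow> 'a \<Rightarrow> real \<Rightarrow> bool" where
  "realized_by_sphere S s \<zeta> \<rho> \<longleftrightarrow> ball (s + \<rho> *\<^sub>R \<zeta>) \<rho> \<inter> S = {}"

definition sphere_property :: "'a::euclidean_space set \<Rightarrow> ereal \<Rightarrow> 'a \<Rightarrow> 'a \<Rightarrow> bool" where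
  "sphere_property S rs s \<zeta> \<longleftrightarrow>
     (rs < \<infinity> \<longrightarrow> realized_by_sphere S s \<zeta> (real_of_ereal rs)) \<and>
     (rs = \<infinity> \<longrightarrow> (\<forall>\<rho>>0. realized_by_sphere S s \<zeta> \<rho>))"

definition ext_exterior_sphere_cond :: "'a::euclidean_space set \<Rightarrow> ('a \<Rightarrow> ereal) \<Rightarrow> bool" where
  "ext_exterior_sphere_cond S r \<longleftrightarrow>
     (\<forall>s\<in>frontier S.
        (s \<in> frontier (interior S) \<longrightarrow>
           (\<exists>\<zeta>\<in>prox_normal_cone S s. norm \<zeta> = 1 \<and> sphere_property S (r s) s \<zeta>)) \<and>
        (s \<notin> frontier (interior S) \<longrightarrow>
           (\<forall>\<zeta>\<in>prox_normal_cone S s. norm \<zeta> = 1 \<longrightarrow> sphere_property S (r s) s \<zeta>)))"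

text \<open>rho(x) = min { r(s)/2 : s in proj_S(x) } (the minimum is attained; written as Inf).\<close>
definition rho_fun :: "'a::euclidean_space set \<Rightarrow> ('a \<Rightarrow> ereal) \<Rightarrow> 'a \<Rightarrow> ereal" where
  "rho_fun S r x = Inf ((\<lambda>s. r s / 2) ` proj_set S x)"

definition varrho_fun :: "'a::euclidean_space set \<Rightarrow> ('a \<Rightarrow> ereal) \<Rightarrow> real \<Rightarrow> 'a \<Rightarrow> ereal" where
  "varrho_fun S r \<gamma> x =
     (if rho_fun S r x = \<infinity> then \<infinity>
      else ereal (max (\<gamma> * infdist x S)
                      (sqrt (\<gamma>\<^sup>2 * (infdist x S)\<^sup>2 + 4 * (real_of_ereal (rho_fun S r x))\<^sup>2) / 2)))"

definition lsc_on :: "'a::topological_space set \<Rightarrow> ('a \<Rightarrow> ereal) \<Rightarrow> bool" where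
  "lsc_on U f \<longleftrightarrow> (\<forall>x\<in>U. \<forall>c. c < f x \<longrightarrow> (\<forall>\<^sub>F z in at x within U. c < f z))"

definition union_closed_balls :: "'a::euclidean_space set \<Rightarrow> ('a \<Rightarrow> ereal) \<Rightarrow> bool" where
  "union_closed_balls U \<rho> \<longleftrightarrow> open U \<and>
     (\<forall>x\<in>U. \<exists>y\<in>U.
        (\<rho> x < \<infinity> \<longrightarrow> x \<in> cball y (real_of_ereal (\<rho> x)) \<and> cball y (real_of_ereal (\<rho> x)) \<subseteq> U) \<and>
        (\<rho> x = \<infinity> \<longrightarrow> (\<forall>\<delta>>0. x \<in> cball (x + \<delta> *\<^sub>R (y - x)) \<delta> \<and>
                                   cball (x + \<delta> *\<^sub>R (y - x)) \<delta> \<subseteq> U)))"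

end

theory Submission
  imports Defs
begin

text \<open>Let $s$ be a projection of $x$ onto $S$, and $d$ their distance. Some unit vector $\zeta$
  at $s$ with $\langle\zeta, x - s\rangle \ge 0$ is realized by an $r(s)$-sphere: if $s$ is a
  limit of interior points, it arises as a limit of normals at the exit points of short segments
  in direction $x - s$; otherwise $(x - s)/d$ will do. If $r(s) = \infty$, then $S$ lies in the
  half-space $\langle\zeta, q - s\rangle \le 0$ and all the balls
  $x + \delta\zeta + \delta \bar B$ avoid it. If the radius is below $d$, the ball centred at $x$
  works. Otherwise $R = 2\rho(x) \ge d$, and the union of the open balls of radii $d$ and $R$
  around $x$ and $s + R\zeta$ contains the required ball, centred on the segment joining the two
  centres. Semicontinuity follows from that of $\rho$: the points of the frontier where $r/2 \le b$
  form a closed set, so if it misses the projections of $x$ it misses those of nearby points.\<close>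

section \<open>Exterior balls as quadratic inequalities\<close>

text \<open>Squaring the distance from \<open>q\<close> to the centre makes \<open>R\<^sup>2\<close>
  cancel. The resulting inequality depends continuously on \<open>s\<close>, \<open>\<zeta>\<close>
  and \<open>R\<close>, so it survives limits.\<close>

lemma ball_avoids_iff:
  fixes S :: "'a::euclidean_space set"
  assumes "norm \<zeta> = 1" "0 \<le> R"
  shows "ball (s + R *\<^sub>R \<zeta>) R \<inter> S = {} \<longleftrightarrow>
    (\<forall>q\<in>S. 2 * R * inner \<zeta> (q - s) \<le> (norm (q - s))\<^sup>2)"
proof -
  have "q \<notin> ball (s + R *\<^sub>R \<zeta>) R \<longleftrightarrow> 2 * R * inner \<zeta> (q - s) \<le> (norm (q - s))\<^sup>2" for q
  proof -
    have 1: "(norm (q - (s + R *\<^sub>R \<zeta>)))\<^sup>2 = (norm (q - s))\<^sup>2 - 2 * R * inner \<zeta> (q - s) + R\<^sup>2"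
    proof -
      have "(norm (q - (s + R *\<^sub>R \<zeta>)))\<^sup>2 = (norm ((q - s) - R *\<^sub>R \<zeta>))\<^sup>2"
        by (simp add: algebra_simps)
      also have "\<dots> = (norm (q - s))\<^sup>2 - 2 * R * inner \<zeta> (q - s) + R\<^sup>2 * (inner \<zeta> \<zeta>)"
        unfolding power2_norm_eq_inner
        by (simp add: inner_diff_left inner_diff_right inner_commute power2_eq_square algebra_simps)
      finally show ?thesis
        using assms(1) by (simp add: dot_square_norm)
    qed
    have "q \<notin> ball (s + R *\<^sub>R \<zeta>) R \<longleftrightarrow> R \<le> norm (q - (s + R *\<^sub>R \<zeta>))"
      by (simp add: dist_norm norm_minus_commute not_less)
    also have "\<dots> \<longleftrightarrow> R\<^sup>2 \<le> (norm (q - (s + R *\<^sub>R \<zeta>)))\<^sup>2"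
      using assms(2) by (simp add: abs_le_square_iff[symmetric])
    finally show ?thesis
      unfolding 1 by linarith
  qed
  then show ?thesis by blast
qed

text \<open>Touching balls can be shrunk: where \<open>inner \<zeta> (q - s)\<close> is nonnegative
  the left side grows with the radius, elsewhere it is negative. Stating this for real
  \<open>R\<close> below \<open>rs\<close> lets finite and infinite radii be treated alike.\<close>

lemma sphere_property_inner_le:
  fixes S :: "'a::euclidean_space set"
  assumes "sphere_property S rs s \<zeta>" "norm \<zeta> = 1" "0 < rs"
    and "0 < R" "ereal R \<le> rs" "q \<in> S"
  shows "2 * R * inner \<zeta> (q - s) \<le> (norm (q - s))\<^sup>2"
proof -
  have "\<exists>P\<ge>R. realized_by_sphere S s \<zeta> P"
  proof (cases rs)
    case (real P)
    then show ?thesis using assms by (auto simp: sphere_property_def)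
  qed (use assms in \<open>auto simp: sphere_property_def\<close>)
  then obtain P where P: "R \<le> P" "ball (s + P *\<^sub>R \<zeta>) P \<inter> S = {}"
    by (auto simp: realized_by_sphere_def)
  have *: "2 * P * inner \<zeta> (q - s) \<le> (norm (q - s))\<^sup>2"
    using P ball_avoids_iff[of \<zeta> P s S] assms by auto
  show ?thesis
  proof (cases "0 \<le> inner \<zeta> (q - s)")
    case True
    then have "2 * R * inner \<zeta> (q - s) \<le> 2 * P * inner \<zeta> (q - s)"
      using P by (simp add: mult_right_mono)
    with * show ?thesis by linarith
  next
    case False
    then have "2 * R * inner \<zeta> (q - s) \<le> 0"
      using assms(4) by (simp add: mult_nonneg_nonpos)
    then show ?thesis by (smt (verit) zero_le_power2)
  qed
qed

section \<open>Metric projections\<close>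

lemma proj_set_dist_pos:
  assumes "s \<in> proj_set S x" "x \<notin> S"
  shows "0 < dist x s"
proof -
  have "x \<noteq> s" using assms by (auto simp: proj_set_def)
  then show ?thesis by simp
qed

text \<open>Otherwise a small step from \<open>s\<close> towards \<open>x\<close> would stay in
  \<open>S\<close> and come nearer to \<open>x\<close>.\<close>

lemma proj_set_frontier:
  fixes S :: "'a::euclidean_space set"
  assumes "s \<in> proj_set S x" "x \<notin> S"
  shows "s \<in> frontier S"
proof -
  have s: "s \<in> S" "dist x s = infdist x S"
    using assms by (auto simp: proj_set_def dist_commute)
  have "s \<notin> interior S"
  proof
    assume "s \<in> interior S"
    then obtain e where e: "e > 0" "ball s e \<subseteq> S"
      using mem_interior by blast
    define d where "d = dist x s"
    have "d > 0" using proj_set_dist_pos assms by (simp add: d_def)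
    define \<tau> where "\<tau> = min 1 (e / (2 * d))"
    have \<tau>: "0 < \<tau>" "\<tau> \<le> 1" "\<tau> * d < e"
      using \<open>d > 0\<close> \<open>e > 0\<close> by (auto simp: \<tau>_def min_def field_simps)
    define q where "q = s + \<tau> *\<^sub>R (x - s)"
    have "dist s q = \<tau> * d"
      using \<tau> by (simp add: q_def d_def dist_norm)
    then have "q \<in> S" using \<tau> e by auto
    have "x - q = (1 - \<tau>) *\<^sub>R (x - s)" by (simp add: q_def algebra_simps)
    then have "dist x q = (1 - \<tau>) * d"
      using \<tau> by (simp add: d_def dist_norm)
    moreover have "d \<le> dist x q"
      using infdist_le[OF \<open>q \<in> S\<close>] s by (simp add: d_def)
    moreover have "0 < \<tau> * d" using \<tau> \<open>d > 0\<close> by simp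
    ultimately show False by (simp add: left_diff_distrib)
  qed
  then show ?thesis using s closure_subset by (auto simp: frontier_def)
qed

section \<open>Realized normals at a projection that do not point away from \<open>x\<close>\<close>

text \<open>Starting at interior points close to \<^term>\<open>s\<close> and moving in direction \<^term>\<open>x - s\<close>, one leaves
  the set near \<^term>\<open>s\<close>; the set lies behind the exit point, so no exterior ball there can
  point backwards.\<close>

lemma forward_normal_nearby:
  fixes S :: "'a::euclidean_space set" and r :: "'a \<Rightarrow> ereal"
  assumes S: "closed S" and pos: "\<forall>s\<in>frontier S. 0 < r s"
    and ext: "ext_exterior_sphere_cond S r"
    and x: "x \<notin> S" and s: "s \<in> proj_set S x" and si: "s \<in> frontier (interior S)"
    and "0 < e"
  shows "\<exists>p\<in>frontier S. dist p s < e \<and>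
    (\<exists>\<zeta>. norm \<zeta> = 1 \<and> 0 \<le> inner \<zeta> (x - s) \<and> sphere_property S (r p) p \<zeta>)"
proof -
  define d where "d = dist x s"
  have sS: "s \<in> S" "d = infdist x S"
    using s by (auto simp: proj_set_def d_def dist_commute)
  have "d > 0" using proj_set_dist_pos s x by (simp add: d_def)
  \<comment> \<open>This scale makes \<open>v\<close> shorter than \<open>e / 2\<close> and keeps
    \<open>s + v\<close> on the segment from \<open>s\<close> to \<open>x\<close>. Hence
    \<open>s + v\<close> is nearer to \<open>x\<close> than \<open>s\<close> is, and lies outside
    \<open>S\<close>.\<close>
  define \<tau> where "\<tau> = min 1 (e / (4 * d))"
  have \<tau>: "0 < \<tau>" "\<tau> \<le> 1" "\<tau> * d < e / 2"
    using \<open>d > 0\<close> \<open>e > 0\<close> by (auto simp: \<tau>_def min_def field_simps)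
  define v where "v = \<tau> *\<^sub>R (x - s)"
  have nv: "norm v = \<tau> * d" using \<tau> by (simp add: v_def d_def dist_norm)
  have "x - (s + v) = (1 - \<tau>) *\<^sub>R (x - s)" by (simp add: v_def algebra_simps)
  then have "dist x (s + v) = (1 - \<tau>) * d"
    using \<tau> by (simp add: d_def dist_norm)
  moreover have "0 < \<tau> * d" using \<tau> \<open>d > 0\<close> by simp
  ultimately have "dist x (s + v) < d" by (simp add: left_diff_distrib)
  then have "s + v \<notin> S" using infdist_le[of "s + v" S x] sS by auto
  then obtain \<eta> where \<eta>: "\<eta> > 0" "ball (s + v) \<eta> \<subseteq> - S"
    using S openE[of "- S" "s + v"] by auto
  have "s \<in> closure (interior S)" using si by (simp add: frontier_def)
  \<comment> \<open>With \<open>a\<close> this close to \<open>s\<close>, the point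
    \<open>a + v\<close> is outside \<open>S\<close> like \<open>s + v\<close>, so the segment from
    \<open>a\<close> to \<open>a + v\<close> must leave the interior.\<close>
  then obtain a where a: "a \<in> interior S" "dist a s < min \<eta> (e / 2)"
    using \<eta> \<open>e > 0\<close> closure_approachable by (metis half_gt_zero min_less_iff_conj)
  have av: "a + v \<notin> S"
  proof -
    have "dist (s + v) (a + v) < \<eta>" using a by (simp add: dist_commute)
    then have "a + v \<in> ball (s + v) \<eta>" by (simp only: mem_ball)
    then show ?thesis using \<eta> by blast
  qed
  define T where "T = {t\<in>{0..1}. a + t *\<^sub>R v \<notin> interior S}"
  have "closed T"
  proof -
    have "T = {0..1} \<inter> (\<lambda>t. a + t *\<^sub>R v) -` (- interior S)" by (auto simp: T_def)
    moreover have "closed ((\<lambda>t::real. a + t *\<^sub>R v) -` (- interior S))"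
      by (intro continuous_closed_vimage continuous_intros) auto
    ultimately show ?thesis by auto
  qed
  have "1 \<in> T" using av interior_subset by (auto simp: T_def)
  have bT: "bdd_below T" by (auto simp: T_def intro: bdd_belowI[of _ 0])
  \<comment> \<open>The first exit from the interior. The exit point \<open>p\<close> is a limit of
    interior points, so case (a) of the sphere condition supplies a normal there.\<close>
  define t where "t = Inf T"
  have tT: "t \<in> T"
    unfolding t_def using \<open>1 \<in> T\<close> bT \<open>closed T\<close> by (intro closed_contains_Inf) auto
  have "t \<noteq> 0" using tT a by (auto simp: T_def)
  with tT have t: "0 < t" "t \<le> 1" by (auto simp: T_def)
  have before: "a + h *\<^sub>R v \<in> interior S" if "0 \<le> h" "h < t" for h
  proof (rule ccontr)
    assume "a + h *\<^sub>R v \<notin> interior S"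
    then have "h \<in> T" using that t by (auto simp: T_def)
    then show False using cInf_lower[OF _ bT] that by (force simp: t_def)
  qed
  define p where "p = a + t *\<^sub>R v"
  have pc: "p \<in> closure (interior S)"
  proof -
    have "((\<lambda>h. a + h *\<^sub>R v) \<longlongrightarrow> p) (at_left t)"
      unfolding p_def by (intro tendsto_intros)
    moreover have "\<forall>\<^sub>F h in at_left t. a + h *\<^sub>R v \<in> closure (interior S)"
      using before closure_subset[of "interior S"] t
      by (intro eventually_at_leftI[of 0]) auto
    ultimately show ?thesis
      by (intro Lim_in_closed_set[OF closed_closure]) auto
  qed
  have pni: "p \<notin> interior S" using tT by (auto simp: T_def p_def)
  have pfi: "p \<in> frontier (interior S)" using pc pni by (simp add: frontier_def)
  have pf: "p \<in> frontier S"
    using pc pni closure_mono[OF interior_subset, of S] by (auto simp: frontier_def)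
  have ps: "p - s = (a - s) + t *\<^sub>R v" by (simp add: p_def)
  have "dist p s \<le> dist a s + t * (\<tau> * d)"
    using norm_triangle_ineq[of "a - s" "t *\<^sub>R v"] t nv unfolding dist_norm ps by simp
  also have "t * (\<tau> * d) \<le> \<tau> * d"
    using t \<tau> \<open>d > 0\<close> by (simp add: mult_left_le_one_le)
  finally have pe: "dist p s < e" using a \<tau> by simp
  obtain \<zeta> where \<zeta>: "norm \<zeta> = 1" "sphere_property S (r p) p \<zeta>"
    using ext pf pfi unfolding ext_exterior_sphere_cond_def by blast
  obtain R where R: "0 < R" "ereal R \<le> r p"
    using pos pf ereal_dense2[of 0 "r p"] by (metis ereal_less(2) less_imp_le)
  \<comment> \<open>The ball at \<open>p\<close> is tested against the point of the segment at
    parameter \<open>t - h\<close>. Dividing by \<open>h\<close> and letting \<open>h\<close> tend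
    to 0 gives \<open>0 \<le> inner \<zeta> v\<close>.\<close>
  have key: "- (2 * R * inner \<zeta> v) \<le> h * (norm v)\<^sup>2" if h: "0 < h" "h < t" for h
  proof -
    have "a + (t - h) *\<^sub>R v \<in> S" using before[of "t - h"] h interior_subset by auto
    moreover have "a + (t - h) *\<^sub>R v - p = - (h *\<^sub>R v)" by (simp add: p_def algebra_simps)
    ultimately have "2 * R * inner \<zeta> (- (h *\<^sub>R v)) \<le> (norm (- (h *\<^sub>R v)))\<^sup>2"
      using sphere_property_inner_le[OF \<zeta>(2,1) _ R] pos pf by metis
    then have "h * (- (2 * R * inner \<zeta> v)) \<le> h * (h * (norm v)\<^sup>2)"
      by (simp add: power_mult_distrib power2_eq_square algebra_simps)
    then show ?thesis using mult_le_cancel_left_pos[OF h(1)] by blast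
  qed
  have "- (2 * R * inner \<zeta> v) \<le> 0"
  proof (rule tendsto_lowerbound)
    show "((\<lambda>h. h * (norm v)\<^sup>2) \<longlongrightarrow> 0) (at_right 0)"
      by (auto intro!: tendsto_eq_intros)
    show "\<forall>\<^sub>F h in at_right 0. - (2 * R * inner \<zeta> v) \<le> h * (norm v)\<^sup>2"
      using key t by (intro eventually_at_rightI[of 0 t]) auto
  qed auto
  then have "0 \<le> inner \<zeta> v" using R by (simp add: zero_le_mult_iff)
  then have "0 \<le> inner \<zeta> (x - s)" using \<tau> by (simp add: v_def zero_le_mult_iff)
  then show ?thesis using pf pe \<zeta> by blast
qed

text \<open>Exit points converge to \<open>s\<close>, and compactness of the unit sphere yields a
  limit normal. The inequality \<open>ereal R < r s\<close> is strict because continuity of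
  \<open>r\<close> then puts \<open>R\<close> below the radii at all late exit points.\<close>

lemma forward_normal_interior:
  fixes S :: "'a::euclidean_space set" and r :: "'a \<Rightarrow> ereal"
  assumes S: "closed S" and pos: "\<forall>s\<in>frontier S. 0 < r s"
    and cont: "continuous_on (frontier S) r"
    and ext: "ext_exterior_sphere_cond S r"
    and x: "x \<notin> S" and s: "s \<in> proj_set S x" and si: "s \<in> frontier (interior S)"
  shows "\<exists>\<zeta>. norm \<zeta> = 1 \<and> 0 \<le> inner \<zeta> (x - s) \<and>
    (\<forall>R. 0 < R \<longrightarrow> ereal R < r s \<longrightarrow> (\<forall>q\<in>S. 2 * R * inner \<zeta> (q - s) \<le> (norm (q - s))\<^sup>2))"
proof -
  have "\<forall>n. \<exists>p \<zeta>. p \<in> frontier S \<and> dist p s < inverse (real (Suc n)) \<and>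
      norm \<zeta> = 1 \<and> 0 \<le> inner \<zeta> (x - s) \<and> sphere_property S (r p) p \<zeta>"
    using forward_normal_nearby[OF S pos ext x s si] by (meson inverse_positive_iff_positive of_nat_0_less_iff zero_less_Suc)
  then obtain p Z where pZ: "\<And>n. p n \<in> frontier S" "\<And>n. dist (p n) s < inverse (real (Suc n))"
      "\<And>n. norm (Z n) = 1" "\<And>n. 0 \<le> inner (Z n) (x - s)"
      "\<And>n. sphere_property S (r (p n)) (p n) (Z n)"
    by metis
  have ps: "p \<longlonglongrightarrow> s"
  proof (rule metric_tendsto_imp_tendsto[OF LIMSEQ_inverse_real_of_nat])
    show "\<forall>\<^sub>F n in sequentially. dist (p n) s \<le> dist (inverse (real (Suc n))) 0"
      using pZ(2) by (auto intro!: always_eventually less_imp_le)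
  qed
  obtain \<zeta> \<phi> where \<phi>: "strict_mono \<phi>" "(Z \<circ> \<phi>) \<longlonglongrightarrow> \<zeta>" and z1: "norm \<zeta> = 1"
  proof -
    have "\<forall>n. Z n \<in> sphere 0 1" using pZ(3) by simp
    then show ?thesis using that compact_sphere[of "0::'a" 1]
      unfolding compact_def by (metis mem_sphere_0)
  qed
  have ps': "(\<lambda>n. p (\<phi> n)) \<longlonglongrightarrow> s"
    using LIMSEQ_subseq_LIMSEQ[OF ps \<phi>(1)] by (simp add: o_def)
  have Z': "(\<lambda>n. Z (\<phi> n)) \<longlonglongrightarrow> \<zeta>" using \<phi>(2) by (simp add: o_def)
  have rs: "(\<lambda>n. r (p (\<phi> n))) \<longlonglongrightarrow> r s"
    using continuous_on_tendsto_compose[OF cont ps'] pZ(1) proj_set_frontier[OF s x] by auto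
  have "0 \<le> inner \<zeta> (x - s)"
    by (rule tendsto_lowerbound[of "\<lambda>n. inner (Z (\<phi> n)) (x - s)" _ sequentially])
      (auto intro!: tendsto_intros Z' pZ(4) always_eventually)
  moreover have "2 * R * inner \<zeta> (q - s) \<le> (norm (q - s))\<^sup>2"
    if R: "0 < R" "ereal R < r s" and q: "q \<in> S" for R q
  proof (rule tendsto_le[OF sequentially_bot])
    show "(\<lambda>n. 2 * R * inner (Z (\<phi> n)) (q - p (\<phi> n))) \<longlonglongrightarrow> 2 * R * inner \<zeta> (q - s)"
      by (intro tendsto_intros Z' ps')
    show "(\<lambda>n. (norm (q - p (\<phi> n)))\<^sup>2) \<longlonglongrightarrow> (norm (q - s))\<^sup>2"
      by (intro tendsto_intros ps')
    have "\<forall>\<^sub>F n in sequentially. ereal R < r (p (\<phi> n))"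
      using order_tendstoD(1)[OF rs R(2)] .
    then show "\<forall>\<^sub>F n in sequentially.
        2 * R * inner (Z (\<phi> n)) (q - p (\<phi> n)) \<le> (norm (q - p (\<phi> n)))\<^sup>2"
      by eventually_elim
        (use sphere_property_inner_le pZ pos R q in \<open>blast intro: less_imp_le\<close>)
  qed
  ultimately show ?thesis using z1 by blast
qed

lemma forward_normal:
  fixes S :: "'a::euclidean_space set" and r :: "'a \<Rightarrow> ereal"
  assumes S: "closed S" and pos: "\<forall>s\<in>frontier S. 0 < r s"
    and cont: "continuous_on (frontier S) r"
    and ext: "ext_exterior_sphere_cond S r"
    and x: "x \<notin> S" and s: "s \<in> proj_set S x"
  obtains \<zeta> where "norm \<zeta> = 1" "0 \<le> inner \<zeta> (x - s)"
    "\<And>R. 0 < R \<Longrightarrow> ereal R \<le> r s \<Longrightarrow> ball (s + R *\<^sub>R \<zeta>) R \<inter> S = {}"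
proof -
  have sf: "s \<in> frontier S" using proj_set_frontier[OF s x] .
  have "\<exists>\<zeta>. norm \<zeta> = 1 \<and> 0 \<le> inner \<zeta> (x - s) \<and>
    (\<forall>R. 0 < R \<longrightarrow> ereal R < r s \<longrightarrow> (\<forall>q\<in>S. 2 * R * inner \<zeta> (q - s) \<le> (norm (q - s))\<^sup>2))"
  proof (cases "s \<in> frontier (interior S)")
    case True
    then show ?thesis using forward_normal_interior[OF S pos cont ext x s] by blast
  next
    case False
    define d where "d = dist x s"
    have sS: "s \<in> S" "d = infdist x S"
      using s by (auto simp: proj_set_def d_def dist_commute)
    have d: "d > 0" using proj_set_dist_pos s x by (simp add: d_def)
    \<comment> \<open>Off the frontier of the interior every unit proximal normal is realized. This
      one is proximal with constant \<open>1 / (2 * d)\<close>, since the ball of radius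
      \<open>d\<close> about \<open>x\<close> avoids \<open>S\<close> and touches it at
      \<open>s\<close>.\<close>
    define \<zeta> where "\<zeta> = (1 / d) *\<^sub>R (x - s)"
    have z1: "norm \<zeta> = 1" using d by (simp add: \<zeta>_def d_def dist_norm)
    have xs: "s + d *\<^sub>R \<zeta> = x" using d by (simp add: \<zeta>_def)
    have "ball x d \<inter> S = {}"
      using infdist_le[of _ S x] sS by force
    then have le: "\<forall>q\<in>S. 2 * d * inner \<zeta> (q - s) \<le> (norm (q - s))\<^sup>2"
      using ball_avoids_iff[of \<zeta> d s S] z1 xs d by simp
    have "\<zeta> \<in> prox_normal_cone S s"
      unfolding prox_normal_cone_def mem_Collect_eq
    proof (intro exI conjI ballI)
      show "0 \<le> 1 / (2 * d)" using d by simp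
      fix q assume "q \<in> S"
      with le d show "inner \<zeta> (q - s) \<le> 1 / (2 * d) * (norm (q - s))\<^sup>2"
        by (simp add: field_simps)
    qed
    then have sp: "sphere_property S (r s) s \<zeta>"
      using ext sf False z1 unfolding ext_exterior_sphere_cond_def by blast
    have "0 \<le> inner \<zeta> (x - s)" using d by (simp add: \<zeta>_def)
    then show ?thesis
      using z1 sphere_property_inner_le[OF sp z1] pos sf by (meson less_imp_le)
  qed
  then obtain \<zeta> where z: "norm \<zeta> = 1" "0 \<le> inner \<zeta> (x - s)"
    and le: "\<And>R q. 0 < R \<Longrightarrow> ereal R < r s \<Longrightarrow> q \<in> S \<Longrightarrow>
      2 * R * inner \<zeta> (q - s) \<le> (norm (q - s))\<^sup>2"
    by blast
  \<comment> \<open>The endpoint \<open>R = r s\<close>, excluded so far, is recovered by letting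
    smaller radii increase to \<open>R\<close>.\<close>
  have "ball (s + R *\<^sub>R \<zeta>) R \<inter> S = {}" if R: "0 < R" "ereal R \<le> r s" for R
  proof -
    have "2 * R * inner \<zeta> (q - s) \<le> (norm (q - s))\<^sup>2" if q: "q \<in> S" for q
    proof (rule tendsto_upperbound)
      show "((\<lambda>P. 2 * P * inner \<zeta> (q - s)) \<longlongrightarrow> 2 * R * inner \<zeta> (q - s)) (at_left R)"
        by (intro tendsto_intros)
      show "\<forall>\<^sub>F P in at_left R. 2 * P * inner \<zeta> (q - s) \<le> (norm (q - s))\<^sup>2"
      proof (rule eventually_at_leftI[OF _ R(1)])
        fix P assume "P \<in> {0<..<R}"
        then have "0 < P" "ereal P < r s"
          using R(2) by (auto intro: less_le_trans[of _ "ereal R"])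
        then show "2 * P * inner \<zeta> (q - s) \<le> (norm (q - s))\<^sup>2" using le q by blast
      qed
    qed auto
    then show ?thesis using ball_avoids_iff[of \<zeta> R s S] z R by simp
  qed
  with z that show ?thesis by blast
qed

section \<open>Closed balls covered by two open balls\<close>

text \<open>A convex combination of the powers of a point with respect to the two given spheres is
  its power with respect to a sphere centred on the segment between the two centres.\<close>

lemma norm_convex_combination_sq:
  fixes q x y :: "'a::real_inner"
  shows "(norm (q - (x + \<mu> *\<^sub>R (y - x))))\<^sup>2 =
    (1 - \<mu>) * (norm (q - x))\<^sup>2 + \<mu> * (norm (q - y))\<^sup>2 - \<mu> * (1 - \<mu>) * (norm (x - y))\<^sup>2"
  unfolding power2_norm_eq_inner
  by (simp add: inner_diff_left inner_diff_right inner_add_left inner_add_right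
      inner_commute algebra_simps)

text \<open>If the second centre \<open>y\<close> is within \<open>w\<close> of \<open>x\<close>,
  the ball about \<open>y\<close> serves. Otherwise the centre \<open>m\<close> is reached by moving
  from \<open>x\<close> towards \<open>y\<close> by \<open>w\<close>. Averaging the powers of
  \<open>q\<close> shows that the square of its distance to \<open>m\<close> exceeds
  \<open>w\<^sup>2\<close> by at least \<open>d\<^sup>2 - 2 * \<mu> * (d\<^sup>2 - T)\<close>, which
  is positive.\<close>

lemma cball_avoiding_set:
  fixes S :: "'a::euclidean_space set"
  assumes ball1: "ball x d \<inter> S = {}" and ball2: "ball (s + R *\<^sub>R \<zeta>) R \<inter> S = {}"
    and d: "0 < d" "norm (x - s) = d" and \<zeta>: "norm \<zeta> = 1" "0 \<le> inner \<zeta> (x - s)"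
    and dR: "d \<le> R" and \<gamma>: "\<gamma>\<^sup>2 < 1" and w: "0 \<le> w" "4 * w\<^sup>2 = \<gamma>\<^sup>2 * d\<^sup>2 + R\<^sup>2"
  shows "\<exists>y. x \<in> cball y w \<and> cball y w \<subseteq> - S"
proof -
  define y where "y = s + R *\<^sub>R \<zeta>"
  define L where "L = norm (x - y)"
  define T where "T = R * inner \<zeta> (x - s)"
  have R: "0 < R" using d dR by simp
  have gd: "\<gamma>\<^sup>2 * d\<^sup>2 < d\<^sup>2" using \<gamma> d by simp
  have L2: "L\<^sup>2 = d\<^sup>2 + R\<^sup>2 - 2 * T"
  proof -
    have "L\<^sup>2 = (norm ((x - s) - R *\<^sub>R \<zeta>))\<^sup>2" by (simp add: L_def y_def algebra_simps)
    also have "\<dots> = (norm (x - s))\<^sup>2 + R\<^sup>2 * inner \<zeta> \<zeta> - 2 * T"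
      unfolding power2_norm_eq_inner T_def
      by (simp add: inner_diff_left inner_diff_right inner_commute power2_eq_square algebra_simps)
    finally show ?thesis using d \<zeta> by (simp add: dot_square_norm)
  qed
  have T0: "0 \<le> T" using R \<zeta> by (simp add: T_def)
  have out1: "d \<le> norm (q - x)" if "q \<in> S" for q
    using ball1 that by (force simp: dist_norm norm_minus_commute)
  have out2: "R \<le> norm (q - y)" if "q \<in> S" for q
    using ball2 that by (force simp: dist_norm norm_minus_commute y_def)
  have dR2: "d\<^sup>2 \<le> R\<^sup>2" using dR d by (simp add: power_mono)
  show ?thesis
  proof (cases "L \<le> w")
    case True
    \<comment> \<open>From \<open>\<gamma>\<^sup>2 < 1\<close> and \<open>d \<le> R\<close> one even
      gets \<open>4 * w\<^sup>2 < 2 * R\<^sup>2\<close>.\<close>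
    have "w\<^sup>2 < R\<^sup>2" using w gd dR2 d by (smt (verit) zero_less_power)
    then have "w < R" using R by (simp add: power_less_imp_less_base)
    then have "cball y w \<subseteq> - S" using out2 by (force simp: dist_norm norm_minus_commute)
    then show ?thesis using True by (auto simp: L_def dist_norm norm_minus_commute)
  next
    case False
    then have Lw: "0 < L" "w < L" using w by auto
    define \<mu> where "\<mu> = w / L"
    have \<mu>: "0 \<le> \<mu>" "\<mu> < 1" "\<mu> * L = w" using Lw w by (auto simp: \<mu>_def)
    define m where "m = x + \<mu> *\<^sub>R (y - x)"
    have xm: "dist m x = w" using \<mu> by (simp add: m_def dist_norm L_def norm_minus_commute)
    \<comment> \<open>This is the positivity of the gain multiplied by \<open>L\<close>, as
      \<open>\<mu> * L = w\<close>.\<close>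
    have pos: "2 * w * (d\<^sup>2 - T) < d\<^sup>2 * L"
    proof (cases "T < d\<^sup>2")
      case True
      \<comment> \<open>Replacing \<open>\<gamma>\<^sup>2\<close> by 1 makes the inequality strict.
        The remainder after expanding is nonpositive because
        \<open>T < d\<^sup>2 \<le> R\<^sup>2\<close>.\<close>
      have "(2 * w * (d\<^sup>2 - T))\<^sup>2 = (\<gamma>\<^sup>2 * d\<^sup>2 + R\<^sup>2) * (d\<^sup>2 - T)\<^sup>2"
        using w by (simp add: power_mult_distrib)
      also have "\<dots> < (d\<^sup>2 + R\<^sup>2) * (d\<^sup>2 - T)\<^sup>2"
        using gd True by (intro mult_strict_right_mono) auto
      also have "\<dots> = (d\<^sup>2 * L)\<^sup>2 + T * (T * (d\<^sup>2 + R\<^sup>2) - 2 * d\<^sup>2 * R\<^sup>2)"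
        unfolding power_mult_distrib L2 by (simp add: power2_eq_square algebra_simps)
      also have "\<dots> \<le> (d\<^sup>2 * L)\<^sup>2"
      proof -
        have "T * (d\<^sup>2 + R\<^sup>2) \<le> d\<^sup>2 * (R\<^sup>2 + R\<^sup>2)"
          using True T0 dR2 by (intro mult_mono) auto
        then have "T * (T * (d\<^sup>2 + R\<^sup>2) - 2 * d\<^sup>2 * R\<^sup>2) \<le> 0"
          using T0 by (intro mult_nonneg_nonpos) auto
        then show ?thesis by simp
      qed
      finally show ?thesis
        using Lw d by (auto intro: power_less_imp_less_base)
    next
      case False
      then have "2 * w * (d\<^sup>2 - T) \<le> 0" using w by (simp add: mult_nonneg_nonpos)
      also have "0 < d\<^sup>2 * L" using d Lw by simp
      finally show ?thesis .
    qed
    have gain: "0 < d\<^sup>2 - 2 * \<mu> * (d\<^sup>2 - T)"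
    proof -
      have "2 * \<mu> * (d\<^sup>2 - T) * L = 2 * w * (d\<^sup>2 - T)" 
        unfolding \<mu>(3)[symmetric] by simp
      then have "2 * \<mu> * (d\<^sup>2 - T) * L < d\<^sup>2 * L" using pos by linarith
      then show ?thesis using Lw by simp
    qed
    have "w < dist m q" if q: "q \<in> S" for q
    proof -
      have "w\<^sup>2 < w\<^sup>2 + (d\<^sup>2 - 2 * \<mu> * (d\<^sup>2 - T))" using gain by simp
      also have "\<dots> = (1 - \<mu>) * d\<^sup>2 + \<mu> * R\<^sup>2 - \<mu> * (1 - \<mu>) * L\<^sup>2"
        unfolding \<mu>(3)[symmetric] power_mult_distrib L2
        by (simp add: power2_eq_square algebra_simps)
      also have "\<dots> \<le> (1 - \<mu>) * (norm (q - x))\<^sup>2 + \<mu> * (norm (q - y))\<^sup>2 - \<mu> * (1 - \<mu>) * L\<^sup>2"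
        using \<mu> out1[OF q] out2[OF q] d R
        by (intro diff_right_mono add_mono mult_left_mono power_mono) auto
      also have "\<dots> = (norm (q - m))\<^sup>2"
        unfolding m_def L_def norm_convex_combination_sq ..
      finally show ?thesis
        using power_less_imp_less_base by (fastforce simp: dist_norm norm_minus_commute)
    qed
    then have "cball m w \<subseteq> - S" by force
    then show ?thesis using xm by auto
  qed
qed

section \<open>Bounds on \<open>rho_fun\<close> and the covering by closed balls\<close>

lemma rho_fun_le:
  assumes "s \<in> proj_set S x"
  shows "rho_fun S r x \<le> r s / 2"
  unfolding rho_fun_def using assms by (intro Inf_lower) auto

text \<open>This excludes \<open>-\<infinity>\<close>, so that \<open>rho_fun\<close> is either
  infinite or a nonnegative real in the case distinctions below.\<close>

lemma rho_fun_nonneg: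
  assumes "\<forall>s\<in>frontier S. 0 < r s" "x \<notin> S"
  shows "0 \<le> rho_fun S r x"
  unfolding rho_fun_def
proof (intro Inf_greatest, clarify)
  fix s assume "s \<in> proj_set S x"
  then have "0 \<le> r s" using assms proj_set_frontier by (blast intro: less_imp_le)
  then show "0 \<le> r s / 2" by simp
qed

lemma proj_set_nonempty:
  assumes "closed S" "S \<noteq> {}"
  obtains s where "s \<in> proj_set S x"
  using infdist_attains_inf[OF assms, of x] by (metis (mono_tags, lifting) dist_commute mem_Collect_eq proj_set_def)

lemma union_closed_balls_varrho:
  fixes S :: "'a::euclidean_space set" and r :: "'a \<Rightarrow> ereal"
  assumes "S \<noteq> {}" and S: "closed S" and pos: "\<forall>s\<in>frontier S. 0 < r s"
    and cont: "continuous_on (frontier S) r"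
    and ext: "ext_exterior_sphere_cond S r" and \<gamma>: "0 \<le> \<gamma>" "\<gamma> < 1"
  shows "union_closed_balls (- S) (varrho_fun S r \<gamma>)"
  unfolding union_closed_balls_def
proof (intro conjI ballI)
  show "open (- S)" using S by auto
  fix x assume "x \<in> - S"
  then have x: "x \<notin> S" by simp
  obtain s where s: "s \<in> proj_set S x" using proj_set_nonempty[OF S \<open>S \<noteq> {}\<close>] .
  obtain \<zeta> where \<zeta>: "norm \<zeta> = 1" "0 \<le> inner \<zeta> (x - s)"
    and ball2: "\<And>R. 0 < R \<Longrightarrow> ereal R \<le> r s \<Longrightarrow> ball (s + R *\<^sub>R \<zeta>) R \<inter> S = {}"
    using forward_normal[OF S pos cont ext x s] by metis
  define d where "d = infdist x S"
  have sS: "s \<in> S" "norm (x - s) = d"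
    using s by (auto simp: proj_set_def d_def dist_norm norm_minus_commute)
  have d: "0 < d" using sS x by auto
  have ball1: "ball x d \<inter> S = {}" using infdist_le[of _ S x] by (force simp: d_def)
  show "\<exists>y\<in>- S.
      (varrho_fun S r \<gamma> x < \<infinity> \<longrightarrow> x \<in> cball y (real_of_ereal (varrho_fun S r \<gamma> x)) \<and>
        cball y (real_of_ereal (varrho_fun S r \<gamma> x)) \<subseteq> - S) \<and>
      (varrho_fun S r \<gamma> x = \<infinity> \<longrightarrow> (\<forall>\<delta>>0. x \<in> cball (x + \<delta> *\<^sub>R (y - x)) \<delta> \<and>
        cball (x + \<delta> *\<^sub>R (y - x)) \<delta> \<subseteq> - S))"
  proof (cases "rho_fun S r x = \<infinity>")
    case True
    then have rs: "r s = \<infinity>" using rho_fun_le[OF s, of r] by (cases "r s") auto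
    have half: "inner \<zeta> (q - s) \<le> 0" if q: "q \<in> S" for q
    proof (rule ccontr)
      assume "\<not> inner \<zeta> (q - s) \<le> 0"
      then have c: "0 < inner \<zeta> (q - s)" by simp
      \<comment> \<open>Chosen so that \<open>2 * R * inner \<zeta> (q - s)\<close> equals
        \<open>(norm (q - s))\<^sup>2 + 1\<close>, just too large.\<close>
      define R where "R = ((norm (q - s))\<^sup>2 + 1) / (2 * inner \<zeta> (q - s))"
      have R: "0 < R" using c by (auto simp: R_def intro!: divide_pos_pos add_nonneg_pos)
      then have "2 * R * inner \<zeta> (q - s) \<le> (norm (q - s))\<^sup>2"
        using ball2[of R] rs ball_avoids_iff[of \<zeta> R s S] \<zeta> q by simp
      then show False using c by (simp add: R_def)
    qed
    \<comment> \<open>A point \<open>q\<close> of the ball satisfies \<open>(norm (q - x))\<^sup>2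
      \<le> 2 * \<delta> * inner \<zeta> (q - x)\<close>. If \<open>q\<close> were in
      \<open>S\<close>, the half-space would make the right side nonpositive, so
      \<open>q = x\<close>, which is outside \<open>S\<close>.\<close>
    have incl: "cball (x + \<delta> *\<^sub>R \<zeta>) \<delta> \<subseteq> - S" if \<delta>: "0 < \<delta>" for \<delta>
    proof
      fix q assume q: "q \<in> cball (x + \<delta> *\<^sub>R \<zeta>) \<delta>"
      show "q \<in> - S"
      proof
        assume "q \<in> S"
        then have "inner \<zeta> (q - x) \<le> 0"
          using half[of q] \<zeta>(2) by (simp add: inner_diff_right)
        moreover have "(norm ((q - x) - \<delta> *\<^sub>R \<zeta>))\<^sup>2 \<le> \<delta>\<^sup>2"
        proof (rule power_mono)
          show "norm ((q - x) - \<delta> *\<^sub>R \<zeta>) \<le> \<delta>"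
            using q by (simp add: dist_norm norm_minus_commute algebra_simps)
        qed simp
        moreover have "(norm ((q - x) - \<delta> *\<^sub>R \<zeta>))\<^sup>2
            = (norm (q - x))\<^sup>2 - 2 * (\<delta> * inner \<zeta> (q - x)) + \<delta>\<^sup>2 * inner \<zeta> \<zeta>"
          unfolding power2_norm_eq_inner
          by (simp add: inner_diff_left inner_diff_right inner_commute power2_eq_square algebra_simps)
        moreover have "inner \<zeta> \<zeta> = 1" using \<zeta> by (simp add: dot_square_norm)
        moreover have "\<delta> * inner \<zeta> (q - x) \<le> 0"
          using calculation(1) \<delta> by (simp add: mult_nonneg_nonpos)
        ultimately have "(norm (q - x))\<^sup>2 \<le> 0" by (simp only: mult_1_right)
        then show False using \<open>q \<in> S\<close> x by simp
      qed
    qed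
    show ?thesis
    proof (intro bexI[of _ "x + \<zeta>"] conjI impI allI)
      show "x + \<zeta> \<in> - S" using incl[of 1] by (auto simp: subset_iff)
    qed (use True incl \<zeta> in \<open>auto simp: varrho_fun_def dist_norm\<close>)
  next
    case False
    then obtain p where p: "rho_fun S r x = ereal p" "0 \<le> p"
      using rho_fun_nonneg[OF pos x] by (cases "rho_fun S r x") auto
    define R where "R = 2 * p"
    define w where "w = max (\<gamma> * d) (sqrt (\<gamma>\<^sup>2 * d\<^sup>2 + R\<^sup>2) / 2)"
    have vw: "varrho_fun S r \<gamma> x = ereal w"
      using p by (simp add: varrho_fun_def w_def d_def R_def power_mult_distrib)
    have w0: "0 \<le> w" using \<gamma> d by (simp add: w_def max_def)
    have Rr: "ereal R \<le> r s"
      using rho_fun_le[OF s, of r] p by (cases "r s") (auto simp: R_def)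
    have "\<exists>y. x \<in> cball y w \<and> cball y w \<subseteq> - S"
    proof (cases "w < d")
      case True
      then have "cball x w \<subseteq> ball x d" by auto
      then show ?thesis using ball1 w0 by (intro exI[of _ x]) auto
    next
      case False
      \<comment> \<open>As \<open>d \<le> w\<close>, the maximum is attained by the square root.
        Then \<open>4 * d\<^sup>2 \<le> \<gamma>\<^sup>2 * d\<^sup>2 + R\<^sup>2\<close> forces
        \<open>d \<le> R\<close>.\<close>
      have "\<gamma> * d < d" using \<gamma> d by simp
      with False have ws: "w = sqrt (\<gamma>\<^sup>2 * d\<^sup>2 + R\<^sup>2) / 2" unfolding w_def by linarith
      have w4: "4 * w\<^sup>2 = \<gamma>\<^sup>2 * d\<^sup>2 + R\<^sup>2" unfolding ws by (simp add: power_divide)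
      have g2: "\<gamma>\<^sup>2 < 1" using \<gamma> by (simp add: abs_square_less_1)
      have "d\<^sup>2 \<le> w\<^sup>2" using False d by (intro power_mono) auto
      moreover have "\<gamma>\<^sup>2 * d\<^sup>2 \<le> d\<^sup>2" using g2 by (simp add: mult_left_le_one_le)
      ultimately have "d\<^sup>2 \<le> R\<^sup>2" using w4 by (smt (verit) zero_le_power2)
      then have dR: "d \<le> R" using p by (auto intro: power2_le_imp_le simp: R_def)
      show ?thesis
        using cball_avoiding_set[OF ball1 ball2 d sS(2) \<zeta> dR g2 w0 w4] Rr dR d by simp
    qed
    then obtain y where y: "x \<in> cball y w" "cball y w \<subseteq> - S" by blast
    moreover have "y \<in> cball y w" using w0 by simp
    ultimately have "y \<in> - S" by blast
    then show ?thesis using y vw by auto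
  qed
qed

section \<open>Lower semicontinuity\<close>

lemma eventually_rho_fun_gt:
  fixes S :: "'a::euclidean_space set" and r :: "'a \<Rightarrow> ereal"
  assumes S: "closed S" "S \<noteq> {}" and cont: "continuous_on (frontier S) r"
    and c: "c < rho_fun S r x"
  shows "\<forall>\<^sub>F z in at x within - S. c < rho_fun S r z"
proof -
  \<comment> \<open>The intermediate value leaves room: an infimum over projections of
    \<open>z\<close> only inherits the weak bound \<open>b \<le> rho_fun S r z\<close>.\<close>
  obtain b where b: "c < b" "b < rho_fun S r x" using dense[OF c] by blast
  define F where "F = {s\<in>frontier S. r s / 2 \<le> b}"
  have "closed F"
  proof -
    have "closed (frontier S \<inter> r -` {..b * 2})"
      using cont by (intro continuous_closed_preimage) auto
    moreover have "r s / 2 \<le> b \<longleftrightarrow> r s \<le> b * 2" for s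
      using ereal_less_divide_iff[of 2 b "r s"] by (simp flip: not_less)
    then have "F = frontier S \<inter> r -` {..b * 2}" by (auto simp: F_def)
    ultimately show ?thesis by simp
  qed
  have FS: "F \<subseteq> S" using S by (auto simp: F_def frontier_def)
  have "\<forall>\<^sub>F z in at x within - S. F \<inter> proj_set S z = {}"
  proof (cases "F = {}")
    case False
    obtain q where q: "q \<in> F" "infdist x F = dist x q"
      using infdist_attains_inf[OF \<open>closed F\<close> False] by blast
    \<comment> \<open>Otherwise the point \<open>q\<close> of \<open>F\<close> nearest to
      \<open>x\<close> would be a projection of \<open>x\<close>, giving
      \<open>rho_fun S r x \<le> b\<close>. Both distances are continuous, so the strict gap
      persists near \<open>x\<close>.\<close>
    have "infdist x S < infdist x F"
    proof (rule ccontr)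
      assume "\<not> ?thesis"
      moreover have "infdist x S \<le> dist x q" using infdist_le FS q by blast
      ultimately have "q \<in> proj_set S x"
        using FS q by (auto simp: proj_set_def dist_commute)
      then have "rho_fun S r x \<le> r q / 2" by (rule rho_fun_le)
      then show False using b q by (auto simp: F_def)
    qed
    moreover have "((\<lambda>z. infdist z F - infdist z S) \<longlongrightarrow> infdist x F - infdist x S) (at x within - S)"
      by (intro tendsto_intros tendsto_infdist)
    ultimately have "\<forall>\<^sub>F z in at x within - S. 0 < infdist z F - infdist z S"
      by (intro order_tendstoD(1)) auto
    then show ?thesis
    proof eventually_elim
      case (elim z)
      then show ?case using infdist_le[of _ F z] by (force simp: proj_set_def dist_commute)
    qed
  qed simp
  then show ?thesis
    unfolding eventually_at_filter
  proof eventually_elim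
    case (elim z)
    show ?case
    proof (intro impI)
      assume z: "z \<noteq> x" "z \<in> - S"
      have "b \<le> rho_fun S r z"
        unfolding rho_fun_def
      proof (intro Inf_greatest, clarify)
        fix s assume s: "s \<in> proj_set S z"
        then have "s \<in> frontier S" using proj_set_frontier z by auto
        then show "b \<le> r s / 2" using elim z s by (auto simp: F_def)
      qed
      then show "c < rho_fun S r z" using b by simp
    qed
  qed
qed

text \<open>For finite \<open>rho_fun\<close> the radius is a continuous function \<open>H\<close>
  of the distance and of \<open>rho_fun\<close>, nondecreasing in the latter on nonnegative values.
  So it suffices to freeze a real \<open>q\<close> that stays below \<open>rho_fun\<close> near
  \<open>x\<close> and still has \<open>H\<close> above \<open>c\<close>.\<close>

lemma lsc_on_varrho:
  fixes S :: "'a::euclidean_space set" and r :: "'a \<Rightarrow> ereal"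
  assumes S: "closed S" "S \<noteq> {}" and pos: "\<forall>s\<in>frontier S. 0 < r s"
    and cont: "continuous_on (frontier S) r"
  shows "lsc_on (- S) (varrho_fun S r \<gamma>)"
  unfolding lsc_on_def
proof (intro ballI allI impI)
  fix x c assume x: "x \<in> - S" and c: "c < varrho_fun S r \<gamma> x"
  define H where "H = (\<lambda>e p. max (\<gamma> * e) (sqrt (\<gamma>\<^sup>2 * e\<^sup>2 + 4 * p\<^sup>2) / 2))"
  have vH: "varrho_fun S r \<gamma> z =
      (if rho_fun S r z = \<infinity> then \<infinity> else ereal (H (infdist z S) (real_of_ereal (rho_fun S r z))))" for z
    by (simp add: varrho_fun_def H_def)
  have low: "ereal (H (infdist z S) q) \<le> varrho_fun S r \<gamma> z"
    if "0 \<le> q" "ereal q \<le> rho_fun S r z" for z q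
  proof (cases "rho_fun S r z")
    case (real p)
    then have "q\<^sup>2 \<le> p\<^sup>2" using that by (intro power_mono) auto
    then have "H (infdist z S) q \<le> H (infdist z S) p"
      unfolding H_def by (intro max.mono) auto
    then show ?thesis using real by (simp add: vH)
  qed (use that in \<open>auto simp: vH\<close>)
  \<comment> \<open>The alternative \<open>q = 0\<close> covers a vanishing or clipped value; there
    nonnegativity of \<open>rho_fun\<close> gives the lower bound nearby.\<close>
  obtain q where q: "0 \<le> q" "ereal q < rho_fun S r x \<or> q = 0" "c < ereal (H (infdist x S) q)"
  proof (cases "rho_fun S r x = \<infinity>")
    case True
    then obtain k where k: "c < ereal k"
      using c vH by (metis ereal_dense2)
    \<comment> \<open>The square root term alone is at least \<open>\<bar>k\<bar>\<close>, so
      \<open>H\<close> exceeds any prescribed real for a suitable \<open>q\<close>.\<close>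
    have "\<bar>k\<bar> \<le> H (infdist x S) \<bar>k\<bar>"
    proof -
      have "2 * \<bar>k\<bar> \<le> sqrt (\<gamma>\<^sup>2 * (infdist x S)\<^sup>2 + 4 * \<bar>k\<bar>\<^sup>2)"
        by (rule real_le_rsqrt) (simp add: power_mult_distrib)
      then show ?thesis by (simp add: H_def)
    qed
    then have "ereal k \<le> ereal (H (infdist x S) \<bar>k\<bar>)" by simp
    with k have "c < ereal (H (infdist x S) \<bar>k\<bar>)" by (rule less_le_trans)
    then show ?thesis using that[of "\<bar>k\<bar>"] True by auto
  next
    case False
    then obtain p where p: "rho_fun S r x = ereal p" "0 \<le> p"
      using rho_fun_nonneg[OF pos, of x] x by (cases "rho_fun S r x") auto
    have cH: "c < ereal (H (infdist x S) (max 0 p))" using c p by (simp add: vH)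
    \<comment> \<open>Approaching \<open>p\<close> from the left keeps \<open>q\<close> strictly
      below it, and clipping at 0 keeps it nonnegative.\<close>
    have "((\<lambda>q. ereal (H (infdist x S) (max 0 q))) \<longlongrightarrow> ereal (H (infdist x S) (max 0 p))) (at_left p)"
      unfolding H_def by (intro tendsto_intros) auto
    from order_tendstoD(1)[OF this cH]
    have "\<forall>\<^sub>F q in at_left p. c < ereal (H (infdist x S) (max 0 q)) \<and> q < p"
      by (intro eventually_conj) (auto simp: eventually_at_filter)
    then obtain q where "c < ereal (H (infdist x S) (max 0 q))" "q < p"
      using eventually_happens' trivial_limit_at_left_real by blast
    then show ?thesis using that[of "max 0 q"] p by (auto simp: max_def split: if_splits)
  qed
  have nonneg: "\<forall>\<^sub>F z in at x within - S. 0 \<le> rho_fun S r z"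
    unfolding eventually_at_filter using rho_fun_nonneg[OF pos] by (auto intro!: always_eventually)
  have ev1: "\<forall>\<^sub>F z in at x within - S. ereal q \<le> rho_fun S r z"
  proof (cases "q = 0")
    case True
    then show ?thesis using nonneg by (simp add: zero_ereal_def)
  next
    case False
    then have "ereal q < rho_fun S r x" using q by simp
    from eventually_rho_fun_gt[OF S cont this] show ?thesis
      by eventually_elim simp
  qed
  have "((\<lambda>z. ereal (H (infdist z S) q)) \<longlongrightarrow> ereal (H (infdist x S) q)) (at x within - S)"
    unfolding H_def by (intro tendsto_intros) auto
  from order_tendstoD(1)[OF this q(3)] ev1
  show "\<forall>\<^sub>F z in at x within - S. c < varrho_fun S r \<gamma> z"
  proof eventually_elim
    case (elim z)
    then show ?case using low[OF q(1)] by (blast intro: less_le_trans)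
  qed
qed

theorem theorem2:
  fixes S :: "'a::euclidean_space set" and r :: "'a \<Rightarrow> ereal" and \<gamma> :: real
  assumes "S \<noteq> {}" and "closed S"
    and "\<forall>s\<in>frontier S. 0 < r s"
    and "continuous_on (frontier S) r"
    and "ext_exterior_sphere_cond S r"
    and "1 / (2 * sqrt 3 - 2) \<le> \<gamma>" and "\<gamma> < 1"
  shows "lsc_on (- S) (varrho_fun S r \<gamma>) \<and> union_closed_balls (- S) (varrho_fun S r \<gamma>)"
proof -
  have "1 \<le> sqrt 3" by simp
  then have "0 \<le> 1 / (2 * sqrt 3 - 2)" by simp
  then have "0 \<le> \<gamma>" using assms(6) by linarith
  then show ?thesis
    using lsc_on_varrho[OF assms(2,1,3,4)] union_closed_balls_varrho[OF assms(1-5)] assms(7) by blast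
qed

end
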